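(* Let $\Sigma$ be a finite nonempty alphabet, let $a=|\Sigma|$, and for positive integers $m,n$ let $\#(m,n)$ denote the number of different $m$-shift de Bruijn sequences of order $n$ over $\Sigma$. Then: (i) for $1\le n\le m$, $\#(m,n)=(a^n)!\,a^{(m-n)(a^n-1)}$; (ii) for $1\le m\le n$, $\#(m,n)=\big((a^m)!\big)^{a^{n-m}}$.
   Context: $\Sigma^n$ denotes the set of all words of length $n$ over $\Sigma$. For a word $w=a_1a_2\cdots a_\ell$, write $w[i..j]=a_i\cdots a_j$. A word $u$ of length $n$ appears in $w$ (as a factor) at a modulo $m$ position if $u=w[im+1..im+n]$ for some integer $i\ge 0$; distinct values of $i$ count as distinct appearances. An $m$-shift de Bruijn sequence of order $n$ over $\Sigma$ is a word $w$ over $\Sigma$, of length $m|\Sigma|^n+(n-m)$, such that each word in $\Sigma^n$ appears exactly once in $w$ as a factor at a modulo $m$ position. Sequences are counted as ordinary (non-circular) words. *)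

theory Defs
  imports Complex_Main
begin

definition words :: "'a set \<Rightarrow> nat \<Rightarrow> 'a list set" where
  "words \<Sigma> n = {u. set u \<subseteq> \<Sigma> \<and> length u = n}"

text \<open>The word \<open>w[i * m + 1 .. i * m + length u]\<close> (letters numbered from 1)
  exists and is equal to \<open>u\<close>.\<close>

definition appears_at_mod :: "nat \<Rightarrow> 'a list \<Rightarrow> 'a list \<Rightarrow> nat \<Rightarrow> bool" where
  "appears_at_mod m u w i \<longleftrightarrow>
     i * m + length u \<le> length w \<and> take (length u) (drop (i * m) w) = u"

text \<open>The length is compared in \<^typ>\<open>int\<close> because \<open>n - m\<close> may be negative.\<close>

definition shift_de_bruijn :: "'a set \<Rightarrow> nat \<Rightarrow> nat \<Rightarrow> 'a list \<Rightarrow> bool" where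
  "shift_de_bruijn \<Sigma> m n w \<longleftrightarrow>
     set w \<subseteq> \<Sigma> \<and>
     int (length w) = int m * int (card \<Sigma>) ^ n + (int n - int m) \<and>
     (\<forall>u \<in> words \<Sigma> n. \<exists>!i. appears_at_mod m u w i)"

definition num_shift_de_bruijn :: "'a set \<Rightarrow> nat \<Rightarrow> nat \<Rightarrow> nat" where
  "num_shift_de_bruijn \<Sigma> m n = card {w. shift_de_bruijn \<Sigma> m n w}"

end

theory Submission
  imports Defs "HOL-Combinatorics.Multiset_Permutations"
begin

text \<open>For \<open>n \<le> m\<close> the factors do not overlap: they may come in any order, and the gaps of length
  \<open>m - n\<close> between them are free.

  For \<open>m \<le> n\<close> the sequences are the Eulerian trails, with any starting vertex, of the graph whose
  vertices are the words of length \<open>n - m\<close> and where \<open>s\<close> has, for every word \<open>y\<close> of length \<open>m\<close>, an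
  edge to the last \<open>n - m\<close> letters of \<open>sy\<close>. As in the BEST theorem, an Eulerian trail starting at
  \<open>s\<close> amounts to an ordering of the out-edges of every vertex such that the last ones form a
  spanning tree directed towards \<open>s\<close>. With \<open>V\<close> vertices of outdegree \<open>d\<close> it remains to see that
  there are \<open>d ^ V\<close> spanning trees with arbitrary root and a marked out-edge of the root. This uses
  only that, for some \<open>k\<close>, the vertex reached by \<open>k\<close> labels does not depend on the start. Such a graph
  with more than one vertex has two vertices with the same out-edges, and merging them divides the
  number of trees by \<open>d\<close>.\<close>

section \<open>Spanning trees of definite automata\<close>

text \<open>The exit of the root \<open>w\<close> is part of the structure, although it is not an edge of the tree.\<close>

definition exit_edges :: "('s \<Rightarrow> 'l \<Rightarrow> 's) \<Rightarrow> ('s \<Rightarrow> 'l) \<Rightarrow> 's set \<Rightarrow> 's \<Rightarrow> ('s \<times> 's) set" where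
  "exit_edges g f V w = {(u, g u (f u)) | u. u \<in> V - {w}}"

text \<open>Labels rather than successors are chosen, so parallel edges give different trees. For
  \<open>w\<close> in \<open>V\<close> the exit of the root is free, and each spanning tree towards
  \<open>w\<close> is counted \<open>card D\<close> times.\<close>

definition tree_exits :: "('s \<Rightarrow> 'l \<Rightarrow> 's) \<Rightarrow> 's set \<Rightarrow> 'l set \<Rightarrow> 's \<Rightarrow> ('s \<Rightarrow> 'l) set" where
  "tree_exits g V D w = {f \<in> V \<rightarrow>\<^sub>E D. \<forall>u\<in>V. (u, w) \<in> (exit_edges g f V w)\<^sup>*}"

section \<open>Reachability in graphs of exits and the merging of twins\<close>

lemma sum_PiE_insert:
  assumes "a \<notin> S"
  shows "(\<Sum>f\<in>insert a S \<rightarrow>\<^sub>E D. F f) = (\<Sum>f\<in>S \<rightarrow>\<^sub>E D. \<Sum>p\<in>D. F (f(a := p)))"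
proof -
  have inj: "inj_on (\<lambda>(y, f). f(a := y)) (D \<times> (S \<rightarrow>\<^sub>E D))"
    using inj_combinator[OF assms, of "\<lambda>_. D"] by simp
  have "(\<Sum>f\<in>insert a S \<rightarrow>\<^sub>E D. F f) = (\<Sum>(p, f)\<in>D \<times> (S \<rightarrow>\<^sub>E D). F (f(a := p)))"
    unfolding PiE_insert_eq by (subst sum.reindex[OF inj]) (simp add: case_prod_unfold)
  also have "\<dots> = (\<Sum>p\<in>D. \<Sum>f\<in>S \<rightarrow>\<^sub>E D. F (f(a := p)))"
    by (simp add: sum.cartesian_product)
  finally show ?thesis by (simp add: sum.swap[of _ _ D])
qed

text \<open>In a functional graph there is only one way to go on, so at most one sink is reached
  from \<open>u\<close>. The classes of vertices that end in different sinks are therefore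
  disjoint.\<close>

lemma single_valued_sink_unique:
  assumes "single_valued K" "(u, s) \<in> K\<^sup>*" "(u, t) \<in> K\<^sup>*" "s \<notin> Domain K" "t \<notin> Domain K"
  shows "s = t"
  using single_valued_confluent[OF assms(1-3)] assms(4,5)
  by (auto simp: Not_Domain_rtrancl)

text \<open>For reachability, merging \<open>b\<close> into \<open>a\<close> amounts to adding an
  edge from the sink \<open>b\<close> to \<open>a\<close>: a path that enters \<open>b\<close> and
  continues must go on to \<open>a\<close>. This brings the merged graph within reach of
  \<open>rtrancl_insert\<close>.\<close>

lemma rtrancl_redirect_iff:
  assumes "b \<notin> Domain K" "a \<noteq> b" "u \<noteq> b" "w \<noteq> b"
  shows "(u, w) \<in> {(s, if t = b then a else t) | s t. (s, t) \<in> K}\<^sup>* \<longleftrightarrow>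
         (u, w) \<in> (insert (b, a) K)\<^sup>*"
proof
  let ?P = "{(s, if t = b then a else t) | s t. (s, t) \<in> K}"
  have "?P \<subseteq> (insert (b, a) K)\<^sup>*"
    by (auto intro: rtrancl.rtrancl_into_rtrancl)
  then show "(u, w) \<in> ?P\<^sup>* \<Longrightarrow> (u, w) \<in> (insert (b, a) K)\<^sup>*"
    using rtrancl_subset_rtrancl by blast
  assume "(u, w) \<in> (insert (b, a) K)\<^sup>*"
  \<comment> \<open>Inner vertices of the path may equal \<open>b\<close>, so the induction runs on
    images under the merging map, which fixes \<open>u\<close> and \<open>w\<close>.\<close>
  then have "((if u = b then a else u), (if w = b then a else w)) \<in> ?P\<^sup>*"
  proof (induction rule: rtrancl_induct)
    case (step y z)
    show ?case
    proof (cases "y = b")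
      case True
      then have "z = a" using step.hyps(2) assms(1) by auto
      then show ?thesis using step.IH True assms(2) by simp
    next
      case False
      then have "(y, if z = b then a else z) \<in> ?P" using step.hyps(2) by auto
      then show ?thesis
        using rtrancl.rtrancl_into_rtrancl[of "if u = b then a else u" y ?P] step.IH False
        by (simp only: if_False)
    qed
  qed simp
  then show "(u, w) \<in> ?P\<^sup>*" using assms by simp
qed

text \<open>\<open>W\<close>, \<open>A\<close> and \<open>B\<close> say in which of the sinks
  \<open>w\<close>, \<open>a\<close>, \<open>b\<close> a vertex ends up. With the exits to
  \<open>x\<close> and \<open>y\<close> added, both twins must get to \<open>w\<close>, one of them
  possibly through the other. After merging only the exit to \<open>x\<close> is left, and it must
  lead to \<open>w\<close> itself.\<close>

lemma twin_reach_other_root: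
  assumes sv: "single_valued K" and sinks: "a \<notin> Domain K" "b \<notin> Domain K"
    and neq: "a \<noteq> b" and inV: "a \<in> V" "b \<in> V"
    and "w \<notin> Domain K" "w \<noteq> a" "w \<noteq> b"
  defines "W \<equiv> \<lambda>u. (u, w) \<in> K\<^sup>*" and "A \<equiv> \<lambda>u. (u, a) \<in> K\<^sup>*" and "B \<equiv> \<lambda>u. (u, b) \<in> K\<^sup>*"
  shows "(\<forall>u\<in>V. (u, w) \<in> (insert (a, x) (insert (b, y) K))\<^sup>*) \<longleftrightarrow>
           (\<forall>u\<in>V. W u \<or> A u \<or> B u) \<and> (W x \<and> W y \<or> W x \<and> A y \<or> B x \<and> W y)"
    and "(\<forall>u\<in>V - {b}. (u, w) \<in> (insert (b, a) (insert (a, x) K))\<^sup>*) \<longleftrightarrow>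
           (\<forall>u\<in>V. W u \<or> A u \<or> B u) \<and> W x"
    and "\<not> (W u \<and> A u)" "\<not> (W u \<and> B u)" "\<not> (A u \<and> B u)"
proof -
  show ex: "\<not> (W u \<and> A u)" "\<not> (W u \<and> B u)" "\<not> (A u \<and> B u)" for u
    using single_valued_sink_unique[OF sv] sinks assms neq unfolding W_def A_def B_def by metis+
  have ab: "A a" "B b" unfolding A_def B_def by auto
  \<comment> \<open>Applying \<open>rtrancl_insert\<close> to each added edge reduces everything to
    reachability in \<open>K\<close>.\<close>
  have 1: "(u, w) \<in> (insert (a, x) (insert (b, y) K))\<^sup>* \<longleftrightarrow>
     (W u \<or> B u \<and> W y) \<or> (A u \<or> B u \<and> A y) \<and> (W x \<or> B x \<and> W y)" for u
    unfolding rtrancl_insert W_def A_def B_def by auto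
  have 2: "(u, w) \<in> (insert (b, a) (insert (a, x) K))\<^sup>* \<longleftrightarrow>
     (W u \<or> A u \<and> W x) \<or> (B u \<or> A u \<and> B x) \<and> (W a \<or> A a \<and> W x)" for u
    unfolding rtrancl_insert W_def A_def B_def by auto
  show "(\<forall>u\<in>V. (u, w) \<in> (insert (a, x) (insert (b, y) K))\<^sup>*) \<longleftrightarrow>
           (\<forall>u\<in>V. W u \<or> A u \<or> B u) \<and> (W x \<and> W y \<or> W x \<and> A y \<or> B x \<and> W y)"
    (is "?L \<longleftrightarrow> ?R")
  proof
    assume L: ?L
    have "W x \<or> B x \<and> W y" "W y \<or> A y \<and> (W x \<or> B x \<and> W y)"
      using bspec[OF L inV(1)] bspec[OF L inV(2)] ex[of a] ex[of b] ab unfolding 1 by auto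
    moreover have "\<forall>u\<in>V. W u \<or> A u \<or> B u" using L unfolding 1 by blast
    ultimately show ?R using ex[of y] by blast
  next
    assume ?R
    then show ?L unfolding 1 by blast
  qed
  show "(\<forall>u\<in>V - {b}. (u, w) \<in> (insert (b, a) (insert (a, x) K))\<^sup>*) \<longleftrightarrow>
           (\<forall>u\<in>V. W u \<or> A u \<or> B u) \<and> W x"
    unfolding 2 using ex ab inV neq by (metis Diff_iff singletonD)
qed

text \<open>With a twin as root only the other twin has an added exit, and two classes suffice. The
  roots \<open>a\<close> and \<open>b\<close> ask for \<open>A y\<close> and \<open>B x\<close>;
  after merging, the root \<open>a\<close> puts no condition on an exit.\<close>

lemma twin_reach_twin_root:
  assumes sv: "single_valued K" and sinks: "a \<notin> Domain K" "b \<notin> Domain K"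
    and neq: "a \<noteq> b" and inV: "a \<in> V" "b \<in> V"
  defines "A \<equiv> \<lambda>u. (u, a) \<in> K\<^sup>*" and "B \<equiv> \<lambda>u. (u, b) \<in> K\<^sup>*"
  shows "(\<forall>u\<in>V. (u, a) \<in> (insert (b, y) K)\<^sup>*) \<longleftrightarrow> (\<forall>u\<in>V. A u \<or> B u) \<and> A y"
    and "(\<forall>u\<in>V. (u, b) \<in> (insert (a, x) K)\<^sup>*) \<longleftrightarrow> (\<forall>u\<in>V. A u \<or> B u) \<and> B x"
    and "(\<forall>u\<in>V - {b}. (u, a) \<in> (insert (b, a) K)\<^sup>*) \<longleftrightarrow> (\<forall>u\<in>V. A u \<or> B u)"
    and "\<not> (A u \<and> B u)"
proof -
  show ex: "\<not> (A u \<and> B u)" for u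
    using single_valued_sink_unique[OF sv] sinks neq unfolding A_def B_def by metis+
  have ab: "A a" "B b" unfolding A_def B_def by auto
  have 1: "(u, a) \<in> (insert (b, y) K)\<^sup>* \<longleftrightarrow> A u \<or> B u \<and> A y"
    "(u, b) \<in> (insert (a, x) K)\<^sup>* \<longleftrightarrow> B u \<or> A u \<and> B x"
    "(u, a) \<in> (insert (b, a) K)\<^sup>* \<longleftrightarrow> A u \<or> B u" for u
    unfolding rtrancl_insert A_def B_def by auto
  show "(\<forall>u\<in>V. (u, a) \<in> (insert (b, y) K)\<^sup>*) \<longleftrightarrow> (\<forall>u\<in>V. A u \<or> B u) \<and> A y"
    "(\<forall>u\<in>V. (u, b) \<in> (insert (a, x) K)\<^sup>*) \<longleftrightarrow> (\<forall>u\<in>V. A u \<or> B u) \<and> B x"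
    "(\<forall>u\<in>V - {b}. (u, a) \<in> (insert (b, a) K)\<^sup>*) \<longleftrightarrow> (\<forall>u\<in>V. A u \<or> B u)"
    unfolding 1 using ex ab inV by blast+
qed

text \<open>The exits \<open>p\<close> of \<open>a\<close> and \<open>q\<close> of \<open>b\<close> vary while all other exits \<open>f\<close> are fixed. Exchanging \<open>p\<close> and \<open>q\<close>
  in some of the cases turns the condition on \<open>(p, q)\<close> into one on \<open>p\<close> alone.\<close>

lemma twin_count_fixed:
  fixes g :: "'s \<Rightarrow> 'l \<Rightarrow> 's"
  assumes fin: "finite V" "finite D" and ab: "a \<in> V" "b \<in> V" "a \<noteq> b"
    and twin: "\<And>y. y \<in> D \<Longrightarrow> g a y = g b y"
    and closed: "\<And>u y. u \<in> V \<Longrightarrow> y \<in> D \<Longrightarrow> g u y \<in> V"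
  defines "h \<equiv> \<lambda>u y. if g u y = b then a else g u y"
  shows "(\<Sum>w\<in>V. \<Sum>p\<in>D. \<Sum>q\<in>D. of_bool (\<forall>u\<in>V. (u, w) \<in> (exit_edges g (f(a := p, b := q)) V w)\<^sup>*)) =
         card D * (\<Sum>w\<in>V - {b}. \<Sum>p\<in>D. of_bool (\<forall>u\<in>V - {b}. (u, w) \<in> (exit_edges h (f(a := p)) (V - {b}) w)\<^sup>*))"
    (is "(\<Sum>w\<in>V. ?H w) = _ * (\<Sum>w\<in>_. ?G w)")
proof -
  \<comment> \<open>\<open>K w\<close> holds the exits that do not depend on \<open>p\<close> and
    \<open>q\<close>. Both twins are sinks of it, and \<open>K b = K a\<close>, so that one graph
    serves both twins as roots.\<close>
  define K where "K w = {(u, g u (f u)) | u. u \<in> V - {a, b, w}}" for w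
  have sv: "single_valued (K w)" and sinks: "a \<notin> Domain (K w)" "b \<notin> Domain (K w)" "w \<notin> Domain (K w)" for w
    by (auto simp: K_def single_valued_def)
  note reach = twin_reach_other_root[OF sv sinks(1,2) ab(3,1,2)]
  note reach' = twin_reach_twin_root[OF sv sinks(1,2) ab(3,1,2)]
  have redirect: "(u, w) \<in> (exit_edges h (f(a := p)) (V - {b}) w)\<^sup>* \<longleftrightarrow>
      (u, w) \<in> (insert (b, a) (exit_edges g (f(a := p)) (V - {b}) w))\<^sup>*"
    if "u \<noteq> b" "w \<noteq> b" for u w p
  proof -
    have "exit_edges h (f(a := p)) (V - {b}) w =
       {(s, if t = b then a else t) | s t. (s, t) \<in> exit_edges g (f(a := p)) (V - {b}) w}"
      unfolding exit_edges_def h_def by blast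
    moreover have "b \<notin> Domain (exit_edges g (f(a := p)) (V - {b}) w)"
      by (auto simp: exit_edges_def)
    ultimately show ?thesis
      using rtrancl_redirect_iff[of b _ a u w] ab(3) that by simp
  qed
  have other: "?H w = card D * ?G w" if w: "w \<in> V - {a, b}" for w
  proof -
    define W A B where "W = (\<lambda>p. (g a p, w) \<in> (K w)\<^sup>*)" and "A = (\<lambda>p. (g a p, a) \<in> (K w)\<^sup>*)"
      and "B = (\<lambda>p. (g a p, b) \<in> (K w)\<^sup>*)"
    define R where "R \<longleftrightarrow> (\<forall>u\<in>V. (u, w) \<in> (K w)\<^sup>* \<or> (u, a) \<in> (K w)\<^sup>* \<or> (u, b) \<in> (K w)\<^sup>*)"
    have EH: "exit_edges g (f(a := p, b := q)) V w = insert (a, g a p) (insert (b, g a q) (K w))"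
      if "q \<in> D" for p q
      using w ab twin[OF that] by (auto simp: exit_edges_def K_def)
    have EG: "exit_edges g (f(a := p)) (V - {b}) w = insert (a, g a p) (K w)" for p
      using w ab by (auto simp: exit_edges_def K_def)
    have H: "(\<forall>u\<in>V. (u, w) \<in> (exit_edges g (f(a := p, b := q)) V w)\<^sup>*) \<longleftrightarrow>
        R \<and> (W p \<and> W q \<or> W p \<and> A q \<or> B p \<and> W q)" if "q \<in> D" for p q
      unfolding EH[OF that] using reach(1)[OF sinks(3)] w unfolding R_def W_def A_def B_def by auto
    have G: "(\<forall>u\<in>V - {b}. (u, w) \<in> (exit_edges h (f(a := p)) (V - {b}) w)\<^sup>*) \<longleftrightarrow> R \<and> W p" for p
      using reach(2)[OF sinks(3), of w "g a p"] w unfolding R_def W_def EG[symmetric]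
      by (simp add: redirect)
    have ex: "\<not> (W p \<and> A p)" "\<not> (W p \<and> B p)" "\<not> (A p \<and> B p)" for p
      using reach(3-5)[OF sinks(3), of w] w unfolding W_def A_def B_def by auto
    have all: "W p \<or> A p \<or> B p" if R "p \<in> D" for p
      using that closed[OF ab(1)] unfolding R_def W_def A_def B_def by auto
    \<comment> \<open>No \<open>p\<close> satisfies both \<open>W\<close> and \<open>B\<close>, so
      the indicator splits into two disjoint parts.\<close>
    have "?H w = (\<Sum>p\<in>D. \<Sum>q\<in>D. of_bool (R \<and> W p \<and> (W q \<or> A q)) + of_bool (R \<and> B p \<and> W q))"
      by (intro sum.cong refl) (use H ex in auto)
    also have "\<dots> = (\<Sum>p\<in>D. \<Sum>q\<in>D. of_bool (R \<and> W p \<and> (W q \<or> A q))) + (\<Sum>p\<in>D. \<Sum>q\<in>D. of_bool (R \<and> B p \<and> W q))"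
      by (simp add: sum.distrib)
    \<comment> \<open>The exchange of \<open>p\<close> and \<open>q\<close>, in the second part
      only. Beside \<open>W p\<close> there now stand the cases \<open>W\<close>, \<open>A\<close>
      and \<open>B\<close> for \<open>q\<close>; under \<open>R\<close> exactly one of them holds,
      so \<open>q\<close> becomes free.\<close>
    also have "(\<Sum>p\<in>D. \<Sum>q\<in>D. of_bool (R \<and> B p \<and> W q)) = (\<Sum>p\<in>D. \<Sum>q\<in>D. of_bool (R \<and> B q \<and> W p) :: nat)"
      by (rule sum.swap)
    also have "(\<Sum>p\<in>D. \<Sum>q\<in>D. of_bool (R \<and> W p \<and> (W q \<or> A q))) + \<dots> = (\<Sum>p\<in>D. \<Sum>q\<in>D. of_bool (R \<and> W p))"
      unfolding sum.distrib[symmetric] by (intro sum.cong refl) (use all ex in auto)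
    also have "\<dots> = card D * ?G w"
      by (simp add: G sum_distrib_left)
    finally show ?thesis .
  qed
  \<comment> \<open>The root \<open>a\<close> asks for \<open>A q\<close> and the root
    \<open>b\<close> for \<open>B p\<close>. After renaming \<open>p\<close> to \<open>q\<close>,
    exactly one of the two holds under \<open>R\<close>, so both roots together match
    \<open>card D\<close> times the root \<open>a\<close> of \<open>h\<close>.\<close>
  have roots: "?H a + ?H b = card D * ?G a"
  proof -
    define A B where "A = (\<lambda>p. (g a p, a) \<in> (K a)\<^sup>*)" and "B = (\<lambda>p. (g a p, b) \<in> (K a)\<^sup>*)"
    define R where "R \<longleftrightarrow> (\<forall>u\<in>V. (u, a) \<in> (K a)\<^sup>* \<or> (u, b) \<in> (K a)\<^sup>*)"
    have EH: "exit_edges g (f(a := p, b := q)) V a = insert (b, g a q) (K a)"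
      "exit_edges g (f(a := p, b := q)) V b = insert (a, g a p) (K a)"
      if "q \<in> D" for p q
      using ab twin[OF that] by (auto simp: exit_edges_def K_def)
    have EG: "exit_edges g (f(a := p)) (V - {b}) a = K a" for p
      using ab by (auto simp: exit_edges_def K_def)
    have H: "(\<forall>u\<in>V. (u, a) \<in> (exit_edges g (f(a := p, b := q)) V a)\<^sup>*) \<longleftrightarrow> R \<and> A q"
      "(\<forall>u\<in>V. (u, b) \<in> (exit_edges g (f(a := p, b := q)) V b)\<^sup>*) \<longleftrightarrow> R \<and> B p" if "q \<in> D" for p q
      unfolding EH[OF that] using reach'(1,2) unfolding R_def A_def B_def by auto
    have G: "(\<forall>u\<in>V - {b}. (u, a) \<in> (exit_edges h (f(a := p)) (V - {b}) a)\<^sup>*) \<longleftrightarrow> R" for p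
      using reach'(3)[of a] ab(3) unfolding R_def EG[symmetric, of p]
      by (simp add: redirect)
    have ex: "\<not> (A p \<and> B p)" for p
      using reach'(4) unfolding A_def B_def by auto
    have all: "A p \<or> B p" if R "p \<in> D" for p
      using that closed[OF ab(1)] unfolding R_def A_def B_def by auto
    have "?H a = (\<Sum>p\<in>D. \<Sum>q\<in>D. of_bool (R \<and> A q))"
      by (intro sum.cong refl) (use H in auto)
    moreover have "?H b = (\<Sum>p\<in>D. \<Sum>q\<in>D. of_bool (R \<and> B p))"
      by (intro sum.cong refl) (use H in auto)
    moreover have "\<dots> = (\<Sum>p\<in>D. \<Sum>q\<in>D. of_bool (R \<and> B q))"
      by (rule sum.swap)
    ultimately have "?H a + ?H b = (\<Sum>p\<in>D. \<Sum>q\<in>D. of_bool (R \<and> A q) + of_bool (R \<and> B q))"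
      by (simp add: sum.distrib distrib_left)
    also have "\<dots> = (\<Sum>p\<in>D. \<Sum>q\<in>D. of_bool R)"
      by (intro sum.cong refl) (use all ex in auto)
    also have "\<dots> = card D * ?G a"
      by (simp add: G)
    finally show ?thesis .
  qed
  have sum_V0: "(\<Sum>w\<in>V - {b}. F w) = F a + (\<Sum>w\<in>V - {a, b}. F w)" for F :: "'s \<Rightarrow> nat"
  proof -
    have "V - {b} - {a} = V - {a, b}" by auto
    then show ?thesis using sum.remove[of "V - {b}" a F] fin(1) ab by simp
  qed
  have sum_V: "(\<Sum>w\<in>V. F w) = (F a + F b) + (\<Sum>w\<in>V - {a, b}. F w)" for F :: "'s \<Rightarrow> nat"
    using sum.remove[OF fin(1) ab(2), of F] sum_V0[of F] by simp
  have "(\<Sum>w\<in>V - {a, b}. ?H w) = (\<Sum>w\<in>V - {a, b}. card D * ?G w)"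
    by (rule sum.cong[OF refl other])
  also have "\<dots> = card D * (\<Sum>w\<in>V - {a, b}. ?G w)"
    by (rule sum_distrib_left[symmetric])
  finally show ?thesis
    unfolding sum_V[of ?H] sum_V0[of ?G] distrib_left roots by (rule arg_cong)
qed

lemma card_tree_exits_sum:
  assumes "finite V" "finite D"
  shows "card (tree_exits g V D w) = (\<Sum>f\<in>V \<rightarrow>\<^sub>E D. of_bool (\<forall>u\<in>V. (u, w) \<in> (exit_edges g f V w)\<^sup>*))"
  unfolding tree_exits_def using finite_PiE[OF assms(1), of "\<lambda>_. D"] assms(2)
  by (simp add: Int_def)

text \<open>Each choice of exits outside the twins contributes by \<open>twin_count_fixed\<close>.
  The sum over the roots has to be moved inside, because the roots \<open>a\<close> and
  \<open>b\<close> can only be treated together.\<close>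

lemma twin_count:
  fixes g :: "'s \<Rightarrow> 'l \<Rightarrow> 's"
  assumes fin: "finite V" "finite D" and ab: "a \<in> V" "b \<in> V" "a \<noteq> b"
    and twin: "\<And>y. y \<in> D \<Longrightarrow> g a y = g b y"
    and closed: "\<And>u y. u \<in> V \<Longrightarrow> y \<in> D \<Longrightarrow> g u y \<in> V"
  shows "(\<Sum>w\<in>V. card (tree_exits g V D w)) =
    card D * (\<Sum>w\<in>V - {b}. card (tree_exits (\<lambda>u y. if g u y = b then a else g u y) (V - {b}) D w))"
proof -
  let ?S = "V - {a, b}" and ?h = "\<lambda>u y. if g u y = b then a else g u y"
  have V: "V = insert b (insert a ?S)" and V0: "V - {b} = insert a ?S" using ab by auto
  have H: "card (tree_exits g V D w) = (\<Sum>f\<in>?S \<rightarrow>\<^sub>E D. \<Sum>p\<in>D. \<Sum>q\<in>D.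
      of_bool (\<forall>u\<in>V. (u, w) \<in> (exit_edges g (f(a := p, b := q)) V w)\<^sup>*))" for w
  proof -
    have "(\<Sum>f\<in>V \<rightarrow>\<^sub>E D. F f) = (\<Sum>f\<in>?S \<rightarrow>\<^sub>E D. \<Sum>p\<in>D. \<Sum>q\<in>D. F (f(a := p, b := q)))"
      for F :: "_ \<Rightarrow> nat"
      using ab by (subst V, subst sum_PiE_insert, simp, subst sum_PiE_insert, simp) simp
    then show ?thesis unfolding card_tree_exits_sum[OF fin] .
  qed
  have G: "card (tree_exits ?h (V - {b}) D w) = (\<Sum>f\<in>?S \<rightarrow>\<^sub>E D. \<Sum>p\<in>D.
      of_bool (\<forall>u\<in>V - {b}. (u, w) \<in> (exit_edges ?h (f(a := p)) (V - {b}) w)\<^sup>*))" for w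
  proof -
    have "(\<Sum>f\<in>(V - {b}) \<rightarrow>\<^sub>E D. F f) = (\<Sum>f\<in>?S \<rightarrow>\<^sub>E D. \<Sum>p\<in>D. F (f(a := p)))"
      for F :: "_ \<Rightarrow> nat"
      unfolding V0 by (subst sum_PiE_insert, simp) simp
    then show ?thesis using card_tree_exits_sum[OF finite_Diff[OF fin(1)] fin(2)] by simp
  qed
  show ?thesis
    unfolding H G sum.swap[of _ "?S \<rightarrow>\<^sub>E D"]
    by (simp only: twin_count_fixed[OF assms] sum_distrib_left)
qed

text \<open>Without twins, two different vertices could always be kept different by one more
  suitable label. From \<open>s\<close> and \<open>t\<close> this would give distinguishing label
  sequences of every length, also of length \<open>k\<close>.\<close>

lemma definite_twins:
  assumes closed: "\<And>u y. u \<in> V \<Longrightarrow> y \<in> D \<Longrightarrow> g u y \<in> V"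
    and definite: "\<And>s t ys. s \<in> V \<Longrightarrow> t \<in> V \<Longrightarrow> set ys \<subseteq> D \<Longrightarrow> length ys = k \<Longrightarrow> foldl g s ys = foldl g t ys"
    and two: "s \<in> V" "t \<in> V" "s \<noteq> t"
  shows "\<exists>a\<in>V. \<exists>b\<in>V. a \<noteq> b \<and> (\<forall>y\<in>D. g a y = g b y)"
proof (rule ccontr)
  assume no: "\<not> ?thesis"
  have in_V: "foldl g s ys \<in> V" if "s \<in> V" "set ys \<subseteq> D" for s ys
    using that by (induction ys arbitrary: s) (auto simp: closed)
  have "\<exists>ys. set ys \<subseteq> D \<and> length ys = j \<and> foldl g s ys \<noteq> foldl g t ys" for j
  proof (induction j)
    case (Suc j)
    then obtain ys where ys: "set ys \<subseteq> D" "length ys = j" "foldl g s ys \<noteq> foldl g t ys" by auto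
    then obtain y where "y \<in> D" "g (foldl g s ys) y \<noteq> g (foldl g t ys) y"
      using no in_V two by metis
    then show ?case using ys by (intro exI[of _ "ys @ [y]"]) auto
  qed (use two in auto)
  then show False using definite two by metis
qed

text \<open>Induction on the number of vertices. A single vertex is the root and chooses its exit
  freely; otherwise merging twins removes one vertex and a factor \<open>card D\<close>, and the
  merged automaton is definite with the same \<open>k\<close>.\<close>

lemma definite_tree_count:
  assumes "finite V" "V \<noteq> {}" and fin: "finite D"
    and "\<And>u y. u \<in> V \<Longrightarrow> y \<in> D \<Longrightarrow> g u y \<in> V"
    and "\<And>s t ys. s \<in> V \<Longrightarrow> t \<in> V \<Longrightarrow> set ys \<subseteq> D \<Longrightarrow> length ys = k \<Longrightarrow> foldl g s ys = foldl g t ys"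
  shows "(\<Sum>w\<in>V. card (tree_exits g V D w)) = card D ^ card V"
  using assms(1,2,4,5)
proof (induction "card V" arbitrary: V g rule: less_induct)
  case less
  note closed = less.prems(3) and definite = less.prems(4)
  show ?case
  proof (cases "\<exists>s\<in>V. \<exists>t\<in>V. s \<noteq> t")
    case False
    then obtain s where V: "V = {s}" using less.prems(2) by blast
    have "tree_exits g V D s = V \<rightarrow>\<^sub>E D" unfolding tree_exits_def V by auto
    then show ?thesis by (simp add: V card_PiE)
  next
    case True
    then obtain s t where "s \<in> V" "t \<in> V" "s \<noteq> t" by blast
    from definite_twins[OF closed definite this] obtain a b
      where ab: "a \<in> V" "b \<in> V" "a \<noteq> b" and twin: "\<forall>y\<in>D. g a y = g b y"
      by blast
    let ?h = "\<lambda>u y. if g u y = b then a else g u y" and ?p = "\<lambda>u. if u = b then a else u"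
    \<comment> \<open>\<open>?p\<close> is a homomorphism onto the merged automaton, also at
      \<open>b\<close>, which moves like its twin \<open>a\<close>. It carries definiteness
      over.\<close>
    have fold: "foldl ?h (?p s) ys = ?p (foldl g s ys)" if "s \<in> V" "set ys \<subseteq> D" for s ys
      using that
    proof (induction ys arbitrary: s)
      case (Cons y ys)
      have "?h (?p s) y = ?p (g s y)" using twin Cons.prems by auto
      then show ?case using Cons closed by simp
    qed simp
    have def': "foldl ?h s ys = foldl ?h t ys"
      if "s \<in> V - {b}" "t \<in> V - {b}" "set ys \<subseteq> D" "length ys = k" for s t ys
    proof -
      have "foldl ?h s ys = ?p (foldl g s ys)" "foldl ?h t ys = ?p (foldl g t ys)"
        using fold[of s ys] fold[of t ys] that by simp_all
      then show ?thesis using definite[of s t ys] that by simp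
    qed
    have "(\<Sum>w\<in>V - {b}. card (tree_exits ?h (V - {b}) D w)) = card D ^ card (V - {b})"
    proof (rule less.hyps[OF _ _ _ _ def'])
      show "card (V - {b}) < card V" using ab less.prems(1) by (rule_tac card_Diff1_less)
      show "finite (V - {b})" "V - {b} \<noteq> {}" using less.prems(1) ab by auto
      show "\<And>u y. u \<in> V - {b} \<Longrightarrow> y \<in> D \<Longrightarrow> ?h u y \<in> V - {b}" using closed ab by auto
    qed
    then show ?thesis
      using twin_count[OF less.prems(1) fin ab] twin closed
        card.remove[OF less.prems(1) ab(2)] by simp
  qed
qed

section \<open>Eulerian trails and last exits\<close>

text \<open>An edge is recorded by source and label, so parallel edges are distinct and an Eulerian
  trail is a permutation of \<open>V \<times> D\<close>.\<close>

fun trail :: "('s \<Rightarrow> 'l \<Rightarrow> 's) \<Rightarrow> 's \<Rightarrow> 'l list \<Rightarrow> ('s \<times> 'l) list" where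
  "trail g s [] = []"
| "trail g s (y # ys) = (s, y) # trail g (g s y) ys"

definition labels_at :: "'s \<Rightarrow> ('s \<times> 'l) list \<Rightarrow> 'l list" where
  "labels_at u es = map snd (filter (\<lambda>e. fst e = u) es)"

lemma labels_at_Nil [simp]: "labels_at u [] = []"
  by (simp add: labels_at_def)

lemma labels_at_Cons [simp]:
  "labels_at u ((s, y) # es) = (if s = u then y # labels_at u es else labels_at u es)"
  by (simp add: labels_at_def)

lemma set_labels_at: "set (labels_at u es) = {y. (u, y) \<in> set es}"
  by (force simp: labels_at_def)

lemma distinct_labels_at: "distinct es \<longleftrightarrow> (\<forall>u. distinct (labels_at u es))"
proof (induction es)
  case (Cons e es)
  then show ?case by (cases e) (auto simp: set_labels_at)
qed simp

lemma map_snd_trail [simp]: "map snd (trail g s ys) = ys"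
  by (induction ys arbitrary: s) auto

lemma length_trail [simp]: "length (trail g s ys) = length ys"
  by (induction ys arbitrary: s) auto

text \<open>A walk can be replayed: the first label left at the current vertex is the next
  step.\<close>

lemma trail_inj_labels_at:
  assumes "length ys = length zs" "\<And>u. labels_at u (trail g s ys) = labels_at u (trail g s zs)"
  shows "ys = zs"
  using assms
proof (induction ys zs arbitrary: s rule: list_induct2)
  case (Cons y ys z zs)
  have "y = z" using Cons.prems[of s] by simp
  moreover have "labels_at u (trail g (g s y) ys) = labels_at u (trail g (g s y) zs)" for u
    using Cons.prems[of u] \<open>y = z\<close> by (auto split: if_splits)
  ultimately show ?case using Cons.IH by blast
qed simp

text \<open>Both sides count the visits of \<open>u\<close>: all but a final one are followed by an
  exit, all but an initial one are preceded by an entry.\<close>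

lemma trail_balance:
  "length (filter (\<lambda>e. fst e = u) (trail g s ys)) + of_bool (foldl g s ys = u) =
   length (filter (\<lambda>e. g (fst e) (snd e) = u) (trail g s ys)) + of_bool (s = u)"
proof (induction ys arbitrary: s)
  case (Cons y ys)
  have "length (filter (\<lambda>e. fst e = u) (trail g s (y # ys))) =
      length (filter (\<lambda>e. fst e = u) (trail g (g s y) ys)) + of_bool (s = u)"
    "length (filter (\<lambda>e. g (fst e) (snd e) = u) (trail g s (y # ys))) =
      length (filter (\<lambda>e. g (fst e) (snd e) = u) (trail g (g s y) ys)) + of_bool (g s y = u)"
    by simp_all
  then show ?case using Cons.IH[of "g s y"] unfolding foldl_Cons by linarith
qed simp

text \<open>A path to \<open>w\<close> can be stopped at its first visit of
  \<open>w\<close>.\<close>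

lemma rtrancl_remove_target_out:
  assumes "(u, w) \<in> E\<^sup>*"
  shows "(u, w) \<in> {(s, t) \<in> E. s \<noteq> w}\<^sup>*"
  using assms
proof (induction rule: converse_rtrancl_induct)
  case (step y z)
  then show ?case
    by (cases "y = w") (auto intro: converse_rtrancl_into_rtrancl)
qed simp

text \<open>The last exit from \<open>u\<close> leads to the end of the walk or to a vertex that is
  left later. Following last exits thus advances in time until the end is reached.\<close>

lemma trail_last_exits:
  assumes "labels_at u (trail g s ys) \<noteq> []"
  shows "(u, foldl g s ys) \<in> {(u, g u (last (labels_at u (trail g s ys)))) | u.
           labels_at u (trail g s ys) \<noteq> []}\<^sup>*"
  using assms
proof (induction ys arbitrary: s u)
  case (Cons y ys)
  let ?L = "\<lambda>u. labels_at u (trail g (g s y) ys)"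
  let ?E = "{(u, g u (last (labels_at u (trail g s (y # ys))))) | u. labels_at u (trail g s (y # ys)) \<noteq> []}"
  \<comment> \<open>A step put in front does not change the last exit of a vertex that the rest of
    the walk leaves.\<close>
  have sub: "{(u, g u (last (?L u))) | u. ?L u \<noteq> []} \<subseteq> ?E"
    by auto
  have IH: "(v, foldl g s (y # ys)) \<in> ?E\<^sup>*" if "?L v \<noteq> []" for v
    using subsetD[OF rtrancl_mono[OF sub] Cons.IH[OF that]] by (simp only: foldl_Cons)
  show ?case
  proof (cases "?L u = []")
    case False
    then show ?thesis using IH by blast
  next
    case True
    \<comment> \<open>\<open>u\<close> is left by the first step only, so this step is its last
      exit.\<close>
    then have "s = u" using Cons.prems by (auto split: if_splits)
    then have "(u, g s y) \<in> ?E" using True by auto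
    moreover have "(g s y, foldl g s (y # ys)) \<in> ?E\<^sup>*"
    proof (cases ys)
      case (Cons z zs)
      then show ?thesis using IH[of "g s y"] by simp
    qed simp
    ultimately show ?thesis by (rule converse_rtrancl_into_rtrancl)
  qed
qed simp

text \<open>\<open>L u\<close> lists the labels still to be used at \<open>u\<close>, in order. The walk that always takes the
  first remaining label can only stop at \<open>z\<close>, and the last exits force it to use everything.\<close>

lemma trail_of_labels:
  assumes fin: "finite V" and "s \<in> V"
    and "\<And>u. u \<notin> V \<Longrightarrow> L u = []"
    and "\<And>u y. u \<in> V \<Longrightarrow> y \<in> set (L u) \<Longrightarrow> g u y \<in> V"
    and "\<And>u. u \<in> V \<Longrightarrow> length (L u) + of_bool (z = u) =
           (\<Sum>v\<in>V. length (filter (\<lambda>y. g v y = u) (L v))) + of_bool (s = u)"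
    and "\<And>u. L u \<noteq> [] \<Longrightarrow> (u, z) \<in> {(u, g u (last (L u))) | u. L u \<noteq> [] \<and> u \<noteq> z}\<^sup>*"
  shows "\<exists>ys. \<forall>u. labels_at u (trail g s ys) = L u"
  using assms(2-)
proof (induction "\<Sum>v\<in>V. length (L v)" arbitrary: L s)
  case 0
  then have "L u = []" for u using fin by (cases "u \<in> V") auto
  then show ?case by (intro exI[of _ "[]"]) simp
next
  case (Suc n)
  note s = Suc.prems(1) and out = Suc.prems(2) and closed = Suc.prems(3)
    and bal = Suc.prems(4) and reach = Suc.prems(5)
  have no_in: "g v y \<noteq> u"
    if "(\<Sum>v\<in>V. length (filter (\<lambda>y. g v y = u) (L v))) = 0" "y \<in> set (L v)" for u v y
  proof -
    have "v \<in> V" using that(2) out by force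
    then have "filter (\<lambda>y. g v y = u) (L v) = []" using that(1) fin by auto
    then show ?thesis using that(2) by (auto simp: filter_empty_conv)
  qed
  show ?case
  proof (cases "L s")
    case Nil
    from bal[OF s] Nil have z: "z = s" and "(\<Sum>v\<in>V. length (filter (\<lambda>y. g v y = s) (L v))) = 0"
      by (auto simp: of_bool_def split: if_splits)
    note no = no_in[OF this(2)]
    have "L u = []" for u
    proof (rule ccontr)
      assume u: "L u \<noteq> []"
      then have "u \<noteq> s" using Nil by auto
      with reach[OF u] z obtain v where "(v, s) \<in> {(u, g u (last (L u))) | u. L u \<noteq> [] \<and> u \<noteq> z}"
        by (auto elim: rtranclE)
      then have "L v \<noteq> []" "g v (last (L v)) = s" by auto
      then show False using no[OF last_in_set] by blast
    qed
    then show ?thesis by (intro exI[of _ "[]"]) simp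
  next
    case (Cons y l)
    define L' where "L' = L(s := l)"
    have y: "y \<in> set (L s)" using Cons by simp
    have "\<exists>ys. \<forall>u. labels_at u (trail g (g s y) ys) = L' u"
    proof (rule Suc.hyps(1))
      show "n = (\<Sum>v\<in>V. length (L' v))"
        using Suc.hyps(2) sum.remove[OF fin s, of "\<lambda>v. length (L v)"]
          sum.remove[OF fin s, of "\<lambda>v. length (L' v)"] Cons by (simp add: L'_def)
      show "g s y \<in> V" using closed[OF s y] .
      show "L' u = []" if "u \<notin> V" for u using that out s by (auto simp: L'_def)
      show "g u y' \<in> V" if "u \<in> V" "y' \<in> set (L' u)" for u y'
        using that closed Cons by (auto simp: L'_def split: if_splits)
      show "length (L' u) + of_bool (z = u) =
           (\<Sum>v\<in>V. length (filter (\<lambda>y. g v y = u) (L' v))) + of_bool (g s y = u)" if u: "u \<in> V" for u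
      proof -
        have "length (L u) = length (L' u) + of_bool (s = u)" using Cons by (auto simp: L'_def)
        moreover have "(\<Sum>v\<in>V. length (filter (\<lambda>y. g v y = u) (L v))) =
          (\<Sum>v\<in>V. length (filter (\<lambda>y. g v y = u) (L' v))) + of_bool (g s y = u)"
          using sum.remove[OF fin s, of "\<lambda>v. length (filter (\<lambda>y. g v y = u) (L v))"]
            sum.remove[OF fin s, of "\<lambda>v. length (filter (\<lambda>y. g v y = u) (L' v))"] Cons
          by (simp add: L'_def)
        ultimately show ?thesis using bal[OF u] by simp
      qed
      show "(u, z) \<in> {(u, g u (last (L' u))) | u. L' u \<noteq> [] \<and> u \<noteq> z}\<^sup>*" if u: "L' u \<noteq> []" for u
      proof -
        let ?E = "{(u, g u (last (L u))) | u. L u \<noteq> [] \<and> u \<noteq> z}"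
        let ?E' = "{(u, g u (last (L' u))) | u. L' u \<noteq> [] \<and> u \<noteq> z}"
        have uE: "(u, z) \<in> ?E\<^sup>*" using reach[of u] u Cons by (cases "u = s") (auto simp: L'_def)
        show ?thesis
        proof (cases "l = [] \<and> s \<noteq> z")
          case False
          have "L' v \<noteq> [] \<and> last (L' v) = last (L v)" if "L v \<noteq> []" "v \<noteq> z" for v
            using that False Cons by (cases "v = s") (auto simp: L'_def)
          then have "?E \<subseteq> ?E'" by force
          then show ?thesis using subsetD[OF rtrancl_mono uE] by simp
        next
          case True
          then have "(\<Sum>v\<in>V. length (filter (\<lambda>y. g v y = s) (L v))) = 0"
            using bal[OF s] Cons by (auto simp: of_bool_def)
          note no = no_in[OF this]
          have "u \<noteq> s" using u True by (auto simp: L'_def)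
          have "(v, z) \<in> ?E\<^sup>* \<Longrightarrow> v \<noteq> s \<Longrightarrow> (v, z) \<in> ?E'\<^sup>*" for v
          proof (induction rule: converse_rtrancl_induct)
            case (step v v')
            then have "v' \<noteq> s" using no by auto
            moreover have "(v, v') \<in> ?E'" using step by (auto simp: L'_def)
            ultimately show ?case using step.IH by (meson converse_rtrancl_into_rtrancl)
          qed simp
          then show ?thesis using uE \<open>u \<noteq> s\<close> by blast
        qed
      qed
    qed
    then obtain ys where ys: "\<And>u. labels_at u (trail g (g s y) ys) = L' u" by blast
    show ?thesis
      by (intro exI[of _ "y # ys"]) (use ys Cons in \<open>auto simp: L'_def\<close>)
  qed
qed

text \<open>The bijection behind the BEST theorem. In a balanced graph an Eulerian trail is closed,
  so its last exits lead to \<open>s\<close>; conversely, orderings with such last exits can be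
  walked completely by \<open>trail_of_labels\<close>.\<close>

lemma euler_trail_labels_bij:
  fixes g :: "'s \<Rightarrow> 'l \<Rightarrow> 's"
  assumes fin: "finite V" "finite D" and D_ne: "D \<noteq> {}" and s: "s \<in> V"
    and closed: "\<And>u y. u \<in> V \<Longrightarrow> y \<in> D \<Longrightarrow> g u y \<in> V"
    and indegree: "\<And>u. u \<in> V \<Longrightarrow> card {e \<in> V \<times> D. g (fst e) (snd e) = u} = card D"
  shows "bij_betw (\<lambda>ys. \<lambda>u\<in>V. labels_at u (trail g s ys))
    {ys. trail g s ys \<in> permutations_of_set (V \<times> D)}
    {L \<in> V \<rightarrow>\<^sub>E permutations_of_set D. (\<lambda>u\<in>V. last (L u)) \<in> tree_exits g V D s}"
    (is "bij_betw ?f ?X ?Y")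
  unfolding bij_betw_def
proof (intro conjI subset_antisym subsetI)
  have set_labels: "set (labels_at u (trail g s ys)) = (if u \<in> V then D else {})" if "ys \<in> ?X" for ys u
    using permutations_of_setD(1)[of "trail g s ys"] that by (auto simp: set_labels_at)
  show "inj_on ?f ?X"
  proof (rule inj_onI)
    fix ys zs assume ys: "ys \<in> ?X" and zs: "zs \<in> ?X" and eq: "?f ys = ?f zs"
    have lab: "labels_at u (trail g s ys) = labels_at u (trail g s zs)" for u
      using fun_cong[OF eq, of u] set_labels[OF ys, of u] set_labels[OF zs, of u]
      by (cases "u \<in> V") auto
    have len: "length ys = length zs"
      using length_finite_permutations_of_set[of "trail g s ys"]
        length_finite_permutations_of_set[of "trail g s zs"] ys zs by simp
    show "ys = zs" by (rule trail_inj_labels_at[OF len lab])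
  qed
  show "L \<in> ?Y" if "L \<in> ?f ` ?X" for L
  proof -
    from that obtain ys where ys: "ys \<in> ?X" and L: "L = ?f ys" by blast
    let ?es = "trail g s ys"
    have es: "distinct ?es" "set ?es = V \<times> D"
      using ys by (auto dest: permutations_of_setD)
    have len: "length (filter P ?es) = card {e \<in> V \<times> D. P e}" for P
      using es by (simp add: distinct_length_filter Int_def conj_commute)
    have "{e \<in> V \<times> D. fst e = s} = {s} \<times> D" using s by auto
    then have "length (filter (\<lambda>e. fst e = s) ?es) = card D" by (simp add: len card_cartesian_product)
    \<comment> \<open>As many edges enter \<open>s\<close> as leave it, so the balance at
      \<open>s\<close> forces the trail to end there.\<close>
    then have end_s: "foldl g s ys = s"
      using trail_balance[of s g s ys] indegree[OF s] by (simp add: len of_bool_def split: if_splits)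
    have L_u: "L u = labels_at u ?es" "L u \<in> permutations_of_set D" "L u \<noteq> []" if "u \<in> V" for u
      using that set_labels[OF ys, of u] es(1) D_ne
      by (auto simp: L permutations_of_set_def distinct_labels_at[of ?es])
    have "(u, s) \<in> (exit_edges g (\<lambda>u\<in>V. last (L u)) V s)\<^sup>*" if u: "u \<in> V" for u
    proof -
      let ?E = "{(u, g u (last (labels_at u ?es))) | u. labels_at u ?es \<noteq> []}"
      \<comment> \<open>\<open>trail_last_exits\<close> also admits the last exit of
        \<open>s\<close>, which is no edge of the tree and is cut off here.\<close>
      have "(u, s) \<in> {(v, t) \<in> ?E. v \<noteq> s}\<^sup>*"
        using trail_last_exits[of u g s ys] rtrancl_remove_target_out[of u s ?E] L_u[OF u] end_s by simp
      moreover have sub: "{(v, t) \<in> ?E. v \<noteq> s} \<subseteq> exit_edges g (\<lambda>u\<in>V. last (L u)) V s"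
      proof -
        have "v \<in> V" if "labels_at v ?es \<noteq> []" for v
          using set_labels[OF ys, of v] that by (auto split: if_splits)
        then show ?thesis by (auto simp: exit_edges_def L_u(1))
      qed
      ultimately show ?thesis using subsetD[OF rtrancl_mono[OF sub]] by blast
    qed
    moreover have "last (L u) \<in> D" if "u \<in> V" for u
      using last_in_set[OF L_u(3)[OF that]] permutations_of_setD(1)[OF L_u(2)[OF that]] by simp
    ultimately have "(\<lambda>u\<in>V. last (L u)) \<in> tree_exits g V D s"
      unfolding tree_exits_def by auto
    moreover have "L \<in> V \<rightarrow>\<^sub>E permutations_of_set D"
      using L_u(2) by (auto simp: L)
    ultimately show "L \<in> ?Y" by simp
  qed
  show "L \<in> ?f ` ?X" if "L \<in> ?Y" for L
  proof -
    from that have L: "L \<in> V \<rightarrow>\<^sub>E permutations_of_set D"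
      and reach: "\<And>u. u \<in> V \<Longrightarrow> (u, s) \<in> (exit_edges g (\<lambda>u\<in>V. last (L u)) V s)\<^sup>*"
      by (auto simp: tree_exits_def)
    have L_u: "set (L u) = D" "distinct (L u)" "length (L u) = card D" if "u \<in> V" for u
      using PiE_mem[OF L that] by (auto dest: permutations_of_setD length_finite_permutations_of_set)
    \<comment> \<open>\<open>L\<close> is \<open>undefined\<close> outside \<open>V\<close>, whereas
      \<open>trail_of_labels\<close> needs the empty list there.\<close>
    define M where "M u = (if u \<in> V then L u else [])" for u
    have "\<exists>ys. \<forall>u. labels_at u (trail g s ys) = M u"
    proof (rule trail_of_labels[where V = V and z = s])
      show "g u y \<in> V" if "u \<in> V" "y \<in> set (M u)" for u y
        using that closed L_u by (auto simp: M_def)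
      show "length (M u) + of_bool (s = u) =
         (\<Sum>v\<in>V. length (filter (\<lambda>y. g v y = u) (M v))) + of_bool (s = u)" if u: "u \<in> V" for u
      proof -
        have "(\<Sum>v\<in>V. length (filter (\<lambda>y. g v y = u) (M v))) = (\<Sum>v\<in>V. card {y \<in> D. g v y = u})"
          by (intro sum.cong refl) (simp add: M_def L_u distinct_length_filter Int_def conj_commute)
        also have "\<dots> = card (SIGMA v:V. {y \<in> D. g v y = u})"
          using fin by simp
        also have "(SIGMA v:V. {y \<in> D. g v y = u}) = {e \<in> V \<times> D. g (fst e) (snd e) = u}"
          by auto
        finally show ?thesis using indegree[OF u] u by (simp add: M_def L_u)
      qed
      show "(u, s) \<in> {(u, g u (last (M u))) | u. M u \<noteq> [] \<and> u \<noteq> s}\<^sup>*" if "M u \<noteq> []" for u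
      proof -
        have "M u \<noteq> []" if "u \<in> V" for u using L_u(1)[OF that] D_ne that by (auto simp: M_def)
        then have sub: "exit_edges g (\<lambda>u\<in>V. last (L u)) V s \<subseteq> {(u, g u (last (M u))) | u. M u \<noteq> [] \<and> u \<noteq> s}"
          by (auto simp: exit_edges_def M_def)
        have "u \<in> V" using that by (auto simp: M_def split: if_splits)
        then show ?thesis using subsetD[OF rtrancl_mono[OF sub] reach] by blast
      qed
    qed (use fin s in \<open>auto simp: M_def\<close>)
    then obtain ys where ys: "\<And>u. labels_at u (trail g s ys) = M u" by blast
    have "distinct (trail g s ys)"
      unfolding distinct_labels_at by (auto simp: ys M_def L_u)
    moreover have "(u, y) \<in> set (trail g s ys) \<longleftrightarrow> (u, y) \<in> V \<times> D" for u y
      using set_labels_at[of u "trail g s ys"] L_u(1)[of u] by (auto simp: ys M_def split: if_splits)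
    ultimately have "ys \<in> ?X" by (auto simp: permutations_of_set_def)
    moreover have "L = ?f ys"
      using L by (auto simp: ys M_def PiE_def extensional_def)
    ultimately show ?thesis by blast
  qed
qed

section \<open>Counting Eulerian trails by their last exits\<close>

lemma card_permutations_last:
  assumes "finite D" "y \<in> D"
  shows "card {l \<in> permutations_of_set D. last l = y} = fact (card D - 1)"
proof -
  have "{l \<in> permutations_of_set D. last l = y} = (\<lambda>l. l @ [y]) ` permutations_of_set (D - {y})"
  proof (intro subset_antisym subsetI)
    fix l assume "l \<in> {l \<in> permutations_of_set D. last l = y}"
    then have l: "set l = D" "distinct l" "last l = y" by (auto dest: permutations_of_setD)
    then have "l \<noteq> []" using assms by auto
    then have *: "l = butlast l @ [y]" using l(3) append_butlast_last_id by metis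
    have "set (butlast l @ [y]) = D" "distinct (butlast l @ [y])" using l(1,2) * by simp_all
    then have "butlast l \<in> permutations_of_set (D - {y})" by (auto simp: permutations_of_set_def)
    with * show "l \<in> (\<lambda>l. l @ [y]) ` permutations_of_set (D - {y})" by blast
  next
    fix l assume "l \<in> (\<lambda>l. l @ [y]) ` permutations_of_set (D - {y})"
    then obtain k where k: "set k = D - {y}" "distinct k" "l = k @ [y]"
      by (auto dest: permutations_of_setD)
    then have "set l = D" "distinct l" using assms(2) by auto
    then show "l \<in> {l \<in> permutations_of_set D. last l = y}" using k(3) by (simp add: permutations_of_setI)
  qed
  then show ?thesis using assms by (simp add: card_image inj_on_def)
qed

text \<open>The orderings are grouped by their last labels. Once these are fixed, each vertex
  arranges its other labels in \<open>fact (card D - 1)\<close> ways.\<close>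

lemma card_euler_trails_from:
  fixes g :: "'s \<Rightarrow> 'l \<Rightarrow> 's"
  assumes fin: "finite V" "finite D" and "D \<noteq> {}" "s \<in> V"
    and "\<And>u y. u \<in> V \<Longrightarrow> y \<in> D \<Longrightarrow> g u y \<in> V"
    and "\<And>u. u \<in> V \<Longrightarrow> card {e \<in> V \<times> D. g (fst e) (snd e) = u} = card D"
  shows "card {ys. trail g s ys \<in> permutations_of_set (V \<times> D)} =
    card (tree_exits g V D s) * fact (card D - 1) ^ card V"
proof -
  let ?Q = "\<lambda>f. Pi\<^sub>E V (\<lambda>u. {l \<in> permutations_of_set D. last l = f u})"
  have sub: "tree_exits g V D s \<subseteq> V \<rightarrow>\<^sub>E D" by (auto simp: tree_exits_def)
  have fin_tree: "finite (tree_exits g V D s)"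
    by (rule finite_subset[OF sub]) (simp add: fin finite_PiE)
  have "{L \<in> V \<rightarrow>\<^sub>E permutations_of_set D. (\<lambda>u\<in>V. last (L u)) \<in> tree_exits g V D s} =
      (\<Union>f\<in>tree_exits g V D s. ?Q f)" (is "?Y = _")
  proof (intro subset_antisym subsetI)
    fix L assume "L \<in> (\<Union>f\<in>tree_exits g V D s. ?Q f)"
    then obtain f where f: "f \<in> tree_exits g V D s" "L \<in> ?Q f" by blast
    have "(\<lambda>u\<in>V. last (L u)) = f"
      using f subsetD[OF sub f(1)] by (intro ext) (auto simp: PiE_def extensional_def Pi_def)
    then show "L \<in> ?Y" using f by (auto simp: PiE_def Pi_def)
  next
    fix L assume "L \<in> ?Y"
    then show "L \<in> (\<Union>f\<in>tree_exits g V D s. ?Q f)"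
      by (intro UN_I[of "\<lambda>u\<in>V. last (L u)"]) (auto simp: PiE_def Pi_def)
  qed
  moreover have "card (\<Union>f\<in>tree_exits g V D s. ?Q f) = (\<Sum>f\<in>tree_exits g V D s. card (?Q f))"
  proof (rule card_UN_disjoint[OF fin_tree])
    show "\<forall>f\<in>tree_exits g V D s. finite (?Q f)" by (simp add: fin finite_PiE)
    show "\<forall>f\<in>tree_exits g V D s. \<forall>h\<in>tree_exits g V D s. f \<noteq> h \<longrightarrow> ?Q f \<inter> ?Q h = {}"
    proof (intro ballI impI, rule ccontr)
      fix f h assume fh: "f \<in> tree_exits g V D s" "h \<in> tree_exits g V D s" "f \<noteq> h" "?Q f \<inter> ?Q h \<noteq> {}"
      then obtain L where "L \<in> ?Q f" "L \<in> ?Q h" by blast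
      then have "f u = h u" if "u \<in> V" for u using that by (auto simp: PiE_def Pi_def)
      then show False using fh(3) PiE_ext subsetD[OF sub] fh(1,2) by metis
    qed
  qed
  moreover have "card (?Q f) = fact (card D - 1) ^ card V" if "f \<in> tree_exits g V D s" for f
  proof -
    have "f u \<in> D" if "u \<in> V" for u
      using subsetD[OF sub \<open>f \<in> tree_exits g V D s\<close>] that by auto
    then show ?thesis by (simp add: card_PiE fin card_permutations_last)
  qed
  ultimately have "card ?Y = card (tree_exits g V D s) * fact (card D - 1) ^ card V"
    by simp
  then show ?thesis using bij_betw_same_card[OF euler_trail_labels_bij[OF assms]] by simp
qed
text \<open>Over all starts there are \<open>card D ^ card V\<close> choices of last exits, one
  factor \<open>card D\<close> per vertex, which completes \<open>fact (card D - 1)\<close> to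
  \<open>fact (card D)\<close>.\<close>

lemma card_euler_trails:
  fixes g :: "'s \<Rightarrow> 'l \<Rightarrow> 's"
  assumes fin: "finite V" "finite D" and ne: "V \<noteq> {}" "D \<noteq> {}"
    and closed: "\<And>u y. u \<in> V \<Longrightarrow> y \<in> D \<Longrightarrow> g u y \<in> V"
    and indegree: "\<And>u. u \<in> V \<Longrightarrow> card {e \<in> V \<times> D. g (fst e) (snd e) = u} = card D"
    and definite: "\<And>s t ys. s \<in> V \<Longrightarrow> t \<in> V \<Longrightarrow> set ys \<subseteq> D \<Longrightarrow> length ys = k \<Longrightarrow> foldl g s ys = foldl g t ys"
  shows "(\<Sum>s\<in>V. card {ys. trail g s ys \<in> permutations_of_set (V \<times> D)}) = fact (card D) ^ card V"
proof -
  have "(\<Sum>s\<in>V. card {ys. trail g s ys \<in> permutations_of_set (V \<times> D)}) =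
      (\<Sum>s\<in>V. card (tree_exits g V D s) * fact (card D - 1) ^ card V)"
    by (intro sum.cong refl card_euler_trails_from assms)
  also have "\<dots> = (card D * fact (card D - 1)) ^ card V"
    using definite_tree_count[OF fin(1) ne(1) fin(2) closed definite]
    by (simp add: power_mult_distrib flip: sum_distrib_right)
  also have "card D * fact (card D - 1) = fact (card D)"
    using fin ne by (simp add: fact_reduce card_gt_0_iff)
  finally show ?thesis .
qed

lemma set_trail_subset:
  assumes "\<And>u y. u \<in> V \<Longrightarrow> y \<in> D \<Longrightarrow> g u y \<in> V" "s \<in> V" "set ys \<subseteq> D"
  shows "set (trail g s ys) \<subseteq> V \<times> D"
  using assms(2,3) by (induction ys arbitrary: s) (auto simp: assms(1))

section \<open>Shift de Bruijn sequences\<close>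

lemma finite_words [simp]: "finite \<Sigma> \<Longrightarrow> finite (words \<Sigma> n)"
  by (simp add: words_def finite_lists_length_eq)

lemma card_words [simp]: "finite \<Sigma> \<Longrightarrow> card (words \<Sigma> n) = card \<Sigma> ^ n"
  by (simp add: words_def card_lists_length_eq)

lemma words_nonempty: "\<Sigma> \<noteq> {} \<Longrightarrow> words \<Sigma> n \<noteq> {}"
proof -
  assume "\<Sigma> \<noteq> {}"
  then obtain x where "x \<in> \<Sigma>" by blast
  then have "replicate n x \<in> words \<Sigma> n" by (auto simp: words_def)
  then show ?thesis by blast
qed

lemma length_concat_words: "ys \<in> words (words \<Sigma> m) N \<Longrightarrow> length (concat ys) = m * N"
  by (induction ys arbitrary: N) (auto simp: words_def)

text \<open>All blocks have length \<open>m\<close>, so the word shows where to cut; surjectivity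
  follows by comparing cardinalities.\<close>

lemma concat_words_bij:
  assumes "finite \<Sigma>"
  shows "bij_betw concat (words (words \<Sigma> m) N) (words \<Sigma> (m * N))"
proof -
  have inj: "inj_on concat (words (words \<Sigma> m) N)"
  proof (rule inj_onI)
    fix xs ys assume "xs \<in> words (words \<Sigma> m) N" "ys \<in> words (words \<Sigma> m) N" "concat xs = concat ys"
    moreover from this have "\<forall>(x, y) \<in> set (zip xs ys). length x = length y"
      unfolding words_def by (fastforce dest: set_zip_leftD set_zip_rightD)
    ultimately show "xs = ys" by (auto simp: words_def concat_eq_concat_iff)
  qed
  have sub: "concat ` words (words \<Sigma> m) N \<subseteq> words \<Sigma> (m * N)"
  proof (rule image_subsetI)
    fix ys assume ys: "ys \<in> words (words \<Sigma> m) N"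
    then have "set (concat ys) \<subseteq> \<Sigma>" by (auto simp: words_def)
    then show "concat ys \<in> words \<Sigma> (m * N)" using length_concat_words[OF ys] by (simp add: words_def)
  qed
  have "concat ` words (words \<Sigma> m) N = words \<Sigma> (m * N)"
    by (rule card_subset_eq[OF _ sub]) (simp_all add: assms card_image[OF inj] power_mult)
  then show ?thesis using inj by (simp add: bij_betw_def)
qed

definition factors :: "nat \<Rightarrow> nat \<Rightarrow> nat \<Rightarrow> 'a list \<Rightarrow> 'a list list" where
  "factors m n N w = map (\<lambda>i. take n (drop (i * m) w)) [0..<N]"

text \<open>Exactly \<open>N\<close> modulo \<open>m\<close> positions leave room for
  \<open>n\<close> letters, as many as there are words. As \<open>factors\<close> lists what stands
  there, unique appearance means that this list is a permutation of the words.\<close>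

lemma shift_de_bruijn_iff:
  assumes "finite \<Sigma>" "\<Sigma> \<noteq> {}" "1 \<le> m" and N: "N = card \<Sigma> ^ n"
  shows "shift_de_bruijn \<Sigma> m n w \<longleftrightarrow>
    w \<in> words \<Sigma> (m * N + n - m) \<and> factors m n N w \<in> permutations_of_set (words \<Sigma> n)"
proof -
  have "N > 0" using assms by (simp add: card_gt_0_iff)
  \<comment> \<open>This removes the truncated subtraction: the length is \<open>m * M + n\<close>,
    and \<open>M\<close> is the index of the last complete factor.\<close>
  then obtain M where M: "N = Suc M" using gr0_implies_Suc by blast
  have len: "m * N + n - m = m * M + n" by (simp add: M)
  have "int (length w) = int m * int (card \<Sigma>) ^ n + (int n - int m) \<longleftrightarrow> length w = m * M + n"
  proof -
    have "int m * int (card \<Sigma>) ^ n + (int n - int m) = int (m * M + n)"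
      using M N by (simp flip: of_nat_power add: algebra_simps)
    then show ?thesis by linarith
  qed
  moreover have "(\<forall>u \<in> words \<Sigma> n. \<exists>!i. appears_at_mod m u w i) \<longleftrightarrow>
      factors m n N w \<in> permutations_of_set (words \<Sigma> n)"
    if w: "set w \<subseteq> \<Sigma>" "length w = m * M + n"
  proof -
    let ?F = "\<lambda>i. take n (drop (i * m) w)"
    have app: "appears_at_mod m u w i \<longleftrightarrow> i < N \<and> ?F i = u" if "u \<in> words \<Sigma> n" for u i
    proof -
      have "length u = n" using that by (simp add: words_def)
      moreover have "i * m + n \<le> m * M + n \<longleftrightarrow> i < N"
        using assms(3) by (simp add: M less_Suc_eq_le mult.commute)
      ultimately show ?thesis using w by (simp add: appears_at_mod_def)
    qed
    have F: "?F i \<in> words \<Sigma> n" if "i < N" for i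
    proof -
      have "i * m \<le> m * M" using that by (simp add: M less_Suc_eq_le mult.commute)
      then have "i * m + n \<le> length w" using w(2) by simp
      then have "length (?F i) = n" by simp
      moreover have "set (?F i) \<subseteq> \<Sigma>" using w(1) set_take_subset set_drop_subset by fast
      ultimately show ?thesis by (simp add: words_def)
    qed
    have "(\<forall>u \<in> words \<Sigma> n. \<exists>!i. appears_at_mod m u w i) \<longleftrightarrow> (\<forall>u \<in> words \<Sigma> n. \<exists>!i. i < N \<and> ?F i = u)"
      using app by simp
    also have "\<dots> \<longleftrightarrow> inj_on ?F {0..<N} \<and> ?F ` {0..<N} = words \<Sigma> n"
    proof
      assume *: "\<forall>u \<in> words \<Sigma> n. \<exists>!i. i < N \<and> ?F i = u"
      have "inj_on ?F {0..<N}"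
      proof (rule inj_onI)
        fix i j assume "i \<in> {0..<N}" "j \<in> {0..<N}" "?F i = ?F j"
        then show "i = j" using bspec[OF * F[of i]] by (metis atLeastLessThan_iff)
      qed
      moreover have "?F ` {0..<N} = words \<Sigma> n"
      proof
        show "?F ` {0..<N} \<subseteq> words \<Sigma> n" using F by (simp add: image_subset_iff)
        show "words \<Sigma> n \<subseteq> ?F ` {0..<N}"
        proof
          fix u assume "u \<in> words \<Sigma> n"
          with * obtain i where "i < N" "?F i = u" by blast
          then show "u \<in> ?F ` {0..<N}" by auto
        qed
      qed
      ultimately show "inj_on ?F {0..<N} \<and> ?F ` {0..<N} = words \<Sigma> n" ..
    next
      assume *: "inj_on ?F {0..<N} \<and> ?F ` {0..<N} = words \<Sigma> n"
      show "\<forall>u \<in> words \<Sigma> n. \<exists>!i. i < N \<and> ?F i = u"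
      proof
        fix u assume "u \<in> words \<Sigma> n"
        then have "u \<in> ?F ` {0..<N}" using * by blast
        then obtain i where i: "i < N" "?F i = u" by auto
        show "\<exists>!i. i < N \<and> ?F i = u"
        proof (rule ex1I)
          show "i < N \<and> ?F i = u" using i by blast
          show "j = i" if "j < N \<and> ?F j = u" for j
            using inj_onD[OF conjunct1[OF *], of j i] that i by simp
        qed
      qed
    qed
    also have "\<dots> \<longleftrightarrow> factors m n N w \<in> permutations_of_set (words \<Sigma> n)"
      unfolding factors_def permutations_of_set_def by (simp add: distinct_map conj_commute)
    finally show ?thesis .
  qed
  ultimately show ?thesis unfolding shift_de_bruijn_def len by (auto simp: words_def)
qed

lemma factors_Suc: "factors m n (Suc N) w = take n w # factors m n N (drop m w)"
  by (simp add: factors_def upt_conv_Cons map_Suc_upt[symmetric] o_def add.commute del: upt_Suc)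

text \<open>A vertex holds the last \<open>r\<close> letters read, so vertex and next block together
  are the factor of length \<open>r + m\<close> at that position. The edges are thus the factors,
  passed in order.\<close>

lemma factors_trail:
  assumes "length s = r" "\<forall>y\<in>set ys. length y = m"
  shows "factors m (r + m) (length ys) (s @ concat ys) =
    map (\<lambda>(s, y). s @ y) (trail (\<lambda>s y. drop m (s @ y)) s ys)"
  using assms
proof (induction ys arbitrary: s)
  case Nil
  then show ?case by (simp add: factors_def)
next
  case (Cons y ys)
  have "drop m (s @ concat (y # ys)) = drop m (s @ y) @ concat ys" using Cons.prems by simp
  then show ?case using Cons.IH[of "drop m (s @ y)"] Cons.prems by (simp add: factors_Suc del: drop_append)
qed

text \<open>Once \<open>m * length ys\<close> is at least the length of \<open>s\<close>, nothing of
  \<open>s\<close> is left, which makes the shift automaton definite.\<close>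

lemma foldl_shift:
  assumes "\<forall>y\<in>set ys. length y = m"
  shows "foldl (\<lambda>s y. drop m (s @ y)) s ys = drop (m * length ys) (s @ concat ys)"
  using assms
proof (induction ys arbitrary: s)
  case (Cons y ys)
  then have "foldl (\<lambda>s y. drop m (s @ y)) s (y # ys) = drop (m * length ys) (drop m (s @ y) @ concat ys)"
    by simp
  also have "drop m (s @ y) @ concat ys = drop m (s @ concat (y # ys))" using Cons.prems by simp
  finally show ?case by (simp only: drop_drop list.size mult_Suc_right add.commute) (simp add: add.commute)
qed simp

text \<open>An edge into \<open>u\<close> is a word \<open>p @ u\<close> cut after \<open>r\<close>
  letters, where the dropped prefix \<open>p\<close> of length \<open>m\<close> is
  arbitrary.\<close>

lemma indegree_shift:
  assumes "finite \<Sigma>" and u: "u \<in> words \<Sigma> r"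
  shows "card {e \<in> words \<Sigma> r \<times> words \<Sigma> m. drop m (fst e @ snd e) = u} = card (words \<Sigma> m)"
proof -
  have "bij_betw (\<lambda>p. (take r (p @ u), drop r (p @ u))) (words \<Sigma> m)
     {e \<in> words \<Sigma> r \<times> words \<Sigma> m. drop m (fst e @ snd e) = u}"
  proof (rule bij_betw_byWitness[where f' = "\<lambda>e. take m (fst e @ snd e)"])
    show "(\<lambda>p. (take r (p @ u), drop r (p @ u))) ` words \<Sigma> m \<subseteq>
       {e \<in> words \<Sigma> r \<times> words \<Sigma> m. drop m (fst e @ snd e) = u}"
    proof (rule image_subsetI)
      fix p assume p: "p \<in> words \<Sigma> m"
      then have sub: "set (p @ u) \<subseteq> \<Sigma>" and "length (p @ u) = m + r"
        using u by (auto simp: words_def)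
      then have "take r (p @ u) \<in> words \<Sigma> r" "drop r (p @ u) \<in> words \<Sigma> m"
        using subset_trans[OF set_take_subset sub, of r] subset_trans[OF set_drop_subset sub, of r]
        unfolding words_def by (simp_all del: take_append drop_append)
      moreover have "drop m (p @ u) = u" using p by (simp add: words_def)
      ultimately show "(take r (p @ u), drop r (p @ u)) \<in>
          {e \<in> words \<Sigma> r \<times> words \<Sigma> m. drop m (fst e @ snd e) = u}"
        by (simp only: mem_Collect_eq mem_Times_iff fst_conv snd_conv append_take_drop_id)
    qed
    show "(\<lambda>e. take m (fst e @ snd e)) ` {e \<in> words \<Sigma> r \<times> words \<Sigma> m. drop m (fst e @ snd e) = u} \<subseteq> words \<Sigma> m"
    proof
      fix p assume "p \<in> (\<lambda>e. take m (fst e @ snd e)) ` {e \<in> words \<Sigma> r \<times> words \<Sigma> m. drop m (fst e @ snd e) = u}"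
      then obtain s y where "s \<in> words \<Sigma> r" "y \<in> words \<Sigma> m" "p = take m (s @ y)" by auto
      then show "p \<in> words \<Sigma> m"
        using set_take_subset[of m "s @ y"] by (auto simp: words_def simp del: take_append)
    qed
    show "\<forall>p\<in>words \<Sigma> m. take m (fst (take r (p @ u), drop r (p @ u)) @ snd (take r (p @ u), drop r (p @ u))) = p"
      by (simp add: append_take_drop_id words_def del: take_append drop_append) (simp add: take_append)
    show "\<forall>e\<in>{e \<in> words \<Sigma> r \<times> words \<Sigma> m. drop m (fst e @ snd e) = u}.
       (take r (take m (fst e @ snd e) @ u), drop r (take m (fst e @ snd e) @ u)) = e"
    proof
      fix e assume e: "e \<in> {e \<in> words \<Sigma> r \<times> words \<Sigma> m. drop m (fst e @ snd e) = u}"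
      then have eq: "take m (fst e @ snd e) @ u = fst e @ snd e"
        by (metis (mono_tags, lifting) append_take_drop_id mem_Collect_eq)
      have "length (fst e) = r" using e by (auto simp: words_def)
      then show "(take r (take m (fst e @ snd e) @ u), drop r (take m (fst e @ snd e) @ u)) = e"
        unfolding eq by simp
    qed
  qed
  then show ?thesis by (simp add: bij_betw_same_card)
qed

text \<open>A factor and the gap after it fill one block of length \<open>m\<close>, so each shift
  by \<open>m\<close> arrives at the next factor.\<close>

lemma factors_interleave:
  assumes "length us = length gs" "\<forall>u\<in>set us. length u = n" "\<forall>v\<in>set gs. length v = m - n" "n \<le> m"
  shows "factors m n (length us) (concat (map2 (@) us gs)) = us"
  using assms
proof (induction us gs rule: list_induct2)
  case Nil
  then show ?case by (simp add: factors_def)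
qed (simp add: factors_Suc)

theorem theorem11:
  fixes \<Sigma> :: "'a set" and a :: nat
  assumes "finite \<Sigma>" and "\<Sigma> \<noteq> {}" and "a = card \<Sigma>"
  shows "(\<forall>m n. 1 \<le> n \<and> n \<le> m \<longrightarrow>
            num_shift_de_bruijn \<Sigma> m n = fact (a ^ n) * a ^ ((m - n) * (a ^ n - 1))) \<and>
         (\<forall>m n. 1 \<le> m \<and> m \<le> n \<longrightarrow>
            num_shift_de_bruijn \<Sigma> m n = (fact (a ^ m)) ^ (a ^ (n - m)))"
proof -
  note fin = assms(1) and ne = assms(2)
  have "num_shift_de_bruijn \<Sigma> m n = fact (card \<Sigma> ^ n) * card \<Sigma> ^ ((m - n) * (card \<Sigma> ^ n - 1))"
    if m: "1 \<le> n" "n \<le> m" for m n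
  proof -
    define N where "N = card \<Sigma> ^ n"
    have N: "N > 0" and a: "card \<Sigma> > 0" using fin ne by (simp_all add: N_def card_gt_0_iff)
    let ?S = "{w. shift_de_bruijn \<Sigma> m n w}" and ?P = "permutations_of_set (words \<Sigma> n)"
    let ?G = "words (words \<Sigma> (m - n)) N" and ?W = "words \<Sigma> (m * N + n - m)"
    \<comment> \<open>\<open>?T\<close> has a gap after the last factor too, so that its words fall
      into \<open>N\<close> blocks of length \<open>m\<close>. The factor
      \<open>card \<Sigma> ^ (m - n)\<close> for this extra gap is cancelled at the end.\<close>
    let ?T = "{v \<in> words \<Sigma> (m * N). factors m n N v \<in> ?P}"
    have S: "w \<in> ?S \<longleftrightarrow> w \<in> ?W \<and> factors m n N w \<in> ?P" for w
      using shift_de_bruijn_iff[OF fin ne _ N_def] m by simp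
    have mN: "m \<le> m * N" using N by simp
    \<comment> \<open>The last factor ends where \<open>w\<close> ends, so appended letters touch no
      factor.\<close>
    have factors_append: "factors m n N (w @ e) = factors m n N w" if "w \<in> ?W" for w e
      unfolding factors_def
    proof (rule map_cong[OF refl])
      fix i assume "i \<in> set [0..<N]"
      then have "(i + 1) * m \<le> N * m" by (intro mult_right_mono) auto
      then have "i * m + n \<le> length w" using that by (simp add: words_def algebra_simps)
      then show "take n (drop (i * m) (w @ e)) = take n (drop (i * m) w)" by simp
    qed
    have "bij_betw (\<lambda>(w, e). w @ e) (?S \<times> words \<Sigma> (m - n)) ?T"
    proof (rule bij_betw_byWitness[where f' = "\<lambda>v. (take (m * N + n - m) v, drop (m * N + n - m) v)"])
      show "\<forall>x\<in>?S \<times> words \<Sigma> (m - n).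
         (\<lambda>v. (take (m * N + n - m) v, drop (m * N + n - m) v)) ((\<lambda>(w, e). w @ e) x) = x"
        using S by (auto simp: words_def)
      show "(\<lambda>(w, e). w @ e) ` (?S \<times> words \<Sigma> (m - n)) \<subseteq> ?T"
      proof clarify
        fix w e assume "shift_de_bruijn \<Sigma> m n w" and e: "e \<in> words \<Sigma> (m - n)"
        then have w: "w \<in> ?W" "factors m n N w \<in> ?P" using S by auto
        have "m * N + n - m + (m - n) = m * N" using m mN by linarith
        then have "w @ e \<in> words \<Sigma> (m * N)" using e w(1) by (simp add: words_def)
        then show "w @ e \<in> words \<Sigma> (m * N) \<and> factors m n N (w @ e) \<in> ?P"
          using w factors_append by simp
      qed
      show "(\<lambda>v. (take (m * N + n - m) v, drop (m * N + n - m) v)) ` ?T \<subseteq> ?S \<times> words \<Sigma> (m - n)"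
      proof (rule image_subsetI)
        fix v assume v: "v \<in> ?T"
        let ?w = "take (m * N + n - m) v" and ?e = "drop (m * N + n - m) v"
        have "m * N + n - m \<le> m * N" "m * N - (m * N + n - m) = m - n" using m mN by linarith+
        then have "?w \<in> ?W" "?e \<in> words \<Sigma> (m - n)"
          using v set_take_subset[of "m * N + n - m" v] set_drop_subset[of "m * N + n - m" v]
          by (auto simp: words_def)
        moreover from this have "factors m n N ?w = factors m n N v"
          using factors_append[of ?w ?e] by simp
        ultimately show "(?w, ?e) \<in> ?S \<times> words \<Sigma> (m - n)"
          using v S by simp
      qed
    qed simp
    then have 1: "card ?S * card \<Sigma> ^ (m - n) = card ?T"
      using fin by (simp add: card_cartesian_product flip: bij_betw_same_card)
    \<comment> \<open>Each block splits into a factor and a gap; the gaps are independent of the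
      order of the factors.\<close>
    have "bij_betw (\<lambda>(us, gs). concat (map2 (@) us gs)) (?P \<times> ?G) ?T"
    proof -
      have PG: "length us = N" "length gs = N" "\<forall>u\<in>set us. length u = n" "\<forall>v\<in>set gs. length v = m - n"
          "map2 (@) us gs \<in> words (words \<Sigma> m) N" "factors m n N (concat (map2 (@) us gs)) = us"
          "map (drop n) (map2 (@) us gs) = gs"
        if us: "us \<in> ?P" and gs: "gs \<in> ?G" for us gs
      proof -
        show 1: "length us = N" "length gs = N"
          using length_finite_permutations_of_set[OF us] gs fin by (simp_all add: N_def words_def[of "words _ _"])
        show 2: "\<forall>u\<in>set us. length u = n" "\<forall>v\<in>set gs. length v = m - n"
          using us gs by (auto simp: words_def dest!: permutations_of_setD(1))
        show "factors m n N (concat (map2 (@) us gs)) = us"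
          using factors_interleave[of us gs n m] 1 2 m by simp
        show "map2 (@) us gs \<in> words (words \<Sigma> m) N"
        proof -
          have "x \<in> words \<Sigma> m" if "x \<in> set (map2 (@) us gs)" for x
          proof -
            from that obtain u v where x: "x = u @ v" and uv: "(u, v) \<in> set (zip us gs)" by auto
            then have "u \<in> words \<Sigma> n" "v \<in> words \<Sigma> (m - n)"
              using permutations_of_setD(1)[OF us] gs set_zip_leftD[OF uv] set_zip_rightD[OF uv]
              by (auto simp: words_def[of "words _ _"])
            then show ?thesis using m by (auto simp: x words_def)
          qed
          then show ?thesis using 1 by (auto simp: words_def[of "words _ _"])
        qed
        show "map (drop n) (map2 (@) us gs) = gs"
          using 1 2 by (intro nth_equalityI) auto
      qed
      show ?thesis
        unfolding bij_betw_def
      proof (intro conjI subset_antisym)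
        show "inj_on (\<lambda>(us, gs). concat (map2 (@) us gs)) (?P \<times> ?G)"
        proof (rule inj_onI, clarify)
          fix us gs us' gs'
          assume *: "us \<in> ?P" "gs \<in> ?G" "us' \<in> ?P" "gs' \<in> ?G"
            and eq: "concat (map2 (@) us gs) = concat (map2 (@) us' gs')"
          have "map2 (@) us gs = map2 (@) us' gs'"
            using inj_onD[OF bij_betw_imp_inj_on[OF concat_words_bij[OF fin]] eq] PG(5) * by blast
          then show "us = us' \<and> gs = gs'" using PG(6,7)[OF *(1,2)] PG(6,7)[OF *(3,4)] by simp
        qed
        show "(\<lambda>(us, gs). concat (map2 (@) us gs)) ` (?P \<times> ?G) \<subseteq> ?T"
        proof clarify
          fix us gs assume *: "us \<in> ?P" "gs \<in> ?G"
          then show "concat (map2 (@) us gs) \<in> words \<Sigma> (m * N) \<and> factors m n N (concat (map2 (@) us gs)) \<in> ?P"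
            using PG(5,6)[OF *] bij_betwE[OF concat_words_bij[OF fin, of m N]] by simp
        qed
        show "?T \<subseteq> (\<lambda>(us, gs). concat (map2 (@) us gs)) ` (?P \<times> ?G)"
        proof
          fix v assume v: "v \<in> ?T"
          then obtain ys where ys: "ys \<in> words (words \<Sigma> m) N" "v = concat ys"
            using concat_words_bij[OF fin, of m N] by (auto simp: bij_betw_def)
          let ?us = "map (take n) ys" and ?gs = "map (drop n) ys"
          have cat: "map2 (@) ?us ?gs = ys" by (intro nth_equalityI) auto
          have "length ys = N" "\<forall>y\<in>set ys. length y = m"
            using ys(1) by (auto simp: words_def)
          then have "factors m n N v = ?us"
            using factors_interleave[of ?us ?gs n m] m(2) by (simp add: cat ys(2))
          then have "?us \<in> ?P" using v by simp
          moreover have "?gs \<in> ?G"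
            using ys(1) by (auto simp: words_def dest: in_set_dropD)
          ultimately show "v \<in> (\<lambda>(us, gs). concat (map2 (@) us gs)) ` (?P \<times> ?G)"
            using ys(2) cat by (intro image_eqI[of _ _ "(?us, ?gs)"]) auto
        qed
      qed
    qed
    then have "card ?T = fact N * (card \<Sigma> ^ (m - n)) ^ N"
      using fin by (simp add: card_cartesian_product N_def flip: bij_betw_same_card)
    \<comment> \<open>Setting the added gap apart leaves \<open>N - 1\<close> of them.\<close>
    also have "\<dots> = (fact N * card \<Sigma> ^ ((m - n) * (N - 1))) * card \<Sigma> ^ (m - n)"
      using N by (cases N) (simp_all add: power_mult)
    finally have "card ?S * card \<Sigma> ^ (m - n) =
        (fact N * card \<Sigma> ^ ((m - n) * (N - 1))) * card \<Sigma> ^ (m - n)"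
      unfolding 1 .
    then have "card ?S = fact N * card \<Sigma> ^ ((m - n) * (N - 1))"
      using a by simp
    then show ?thesis by (simp add: num_shift_de_bruijn_def N_def)
  qed
  moreover have "num_shift_de_bruijn \<Sigma> m n = fact (card \<Sigma> ^ m) ^ (card \<Sigma> ^ (n - m))"
    if m: "1 \<le> m" "m \<le> n" for m n
  proof -
    \<comment> \<open>\<open>r\<close> is the length of the vertices; for \<open>m = n\<close> the
      empty word is the only vertex.\<close>
    define r where "r = n - m"
    have n: "n = r + m" using m by (simp add: r_def)
    let ?V = "words \<Sigma> r" and ?D = "words \<Sigma> m" and ?g = "\<lambda>s y. drop m (s @ y)"
    let ?N = "card \<Sigma> ^ n" and ?cat = "\<lambda>(s, y). s @ y"
    have closed: "?g u y \<in> ?V" if "u \<in> ?V" "y \<in> ?D" for u y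
      using that set_drop_subset[of m "u @ y"] by (auto simp: words_def simp del: drop_append)
    have cat: "bij_betw ?cat (?V \<times> ?D) (words \<Sigma> n)"
    proof (rule bij_betw_byWitness[where f' = "\<lambda>u. (take r u, drop r u)"])
      show "(\<lambda>u. (take r u, drop r u)) ` words \<Sigma> n \<subseteq> ?V \<times> ?D"
        using set_take_subset set_drop_subset by (fastforce simp: words_def n)
    qed (auto simp: words_def n)
    have card_VD: "card (?V \<times> ?D) = ?N"
      using fin by (simp add: card_cartesian_product n power_add)
    \<comment> \<open>Concatenation identifies the edges with the words of length
      \<open>n\<close>.\<close>
    have perms: "es \<in> permutations_of_set (?V \<times> ?D) \<longleftrightarrow> map ?cat es \<in> permutations_of_set (words \<Sigma> n)"
      if "set es \<subseteq> ?V \<times> ?D" for es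
    proof -
      have "inj_on ?cat (set es)" using cat that by (meson bij_betw_def inj_on_subset)
      moreover have "?cat ` set es = words \<Sigma> n \<longleftrightarrow> set es = ?V \<times> ?D"
        using inj_on_image_eq_iff[of ?cat "?V \<times> ?D" "set es" "?V \<times> ?D"] cat that
        by (simp add: bij_betw_def)
      ultimately show ?thesis by (simp add: permutations_of_set_def distinct_map)
    qed
    \<comment> \<open>The start vertex is formed by the first \<open>r\<close> letters of the
      sequence, the labels by the blocks of length \<open>m\<close> after them. All starts occur, as
      sequences are not circular.\<close>
    let ?X = "SIGMA s:?V. {ys. trail ?g s ys \<in> permutations_of_set (?V \<times> ?D)}"
    have X: "(s, ys) \<in> ?X \<longleftrightarrow> s \<in> ?V \<and> ys \<in> words ?D ?N \<and>
        factors m n ?N (s @ concat ys) \<in> permutations_of_set (words \<Sigma> n)" for s ys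
    proof -
      have "ys \<in> words ?D ?N" if "trail ?g s ys \<in> permutations_of_set (?V \<times> ?D)"
      proof -
        have "set (map snd (trail ?g s ys)) \<subseteq> ?D"
          unfolding set_map permutations_of_setD(1)[OF that] by auto
        then show ?thesis
          using length_finite_permutations_of_set[OF that] card_VD by (simp add: words_def[of ?D])
      qed
      moreover have "trail ?g s ys \<in> permutations_of_set (?V \<times> ?D) \<longleftrightarrow>
         factors m n ?N (s @ concat ys) \<in> permutations_of_set (words \<Sigma> n)"
        if "s \<in> ?V" "ys \<in> words ?D ?N"
      proof -
        have "factors m n ?N (s @ concat ys) = map ?cat (trail ?g s ys)"
          using factors_trail[of s r ys m] that n by (auto simp: words_def)
        moreover have "set (trail ?g s ys) \<subseteq> ?V \<times> ?D"
          using that closed by (intro set_trail_subset) (auto simp: words_def[of ?D])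
        ultimately show ?thesis using perms by simp
      qed
      ultimately show ?thesis by auto
    qed
    have len: "m * ?N + n - m = r + m * ?N" by (simp add: n)
    have "bij_betw (\<lambda>(s, ys). s @ concat ys) ?X {w. shift_de_bruijn \<Sigma> m n w}"
      unfolding bij_betw_def
    proof (intro conjI subset_antisym subsetI)
      show "inj_on (\<lambda>(s, ys). s @ concat ys) ?X"
      proof (rule inj_onI)
        fix p q assume pq: "p \<in> ?X" "q \<in> ?X" "(\<lambda>(s, ys). s @ concat ys) p = (\<lambda>(s, ys). s @ concat ys) q"
        obtain s ys t zs where [simp]: "p = (s, ys)" "q = (t, zs)" by (cases p; cases q)
        have in_words: "s \<in> ?V" "t \<in> ?V" "ys \<in> words ?D ?N" "zs \<in> words ?D ?N"
          using pq(1,2) X by simp_all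
        then have "s = t \<and> concat ys = concat zs" using pq(3) by (simp add: words_def)
        then show "p = q"
          using inj_onD[OF bij_betw_imp_inj_on[OF concat_words_bij[OF fin, of m ?N]]] in_words by simp
      qed
      fix w assume "w \<in> (\<lambda>(s, ys). s @ concat ys) ` ?X"
      then obtain s ys where w: "w = s @ concat ys" and sy: "(s, ys) \<in> ?X" by auto
      have "concat ys \<in> words \<Sigma> (m * ?N)"
        using sy X concat_words_bij[OF fin, of m ?N] bij_betwE by blast
      then have "w \<in> words \<Sigma> (r + m * ?N)" using sy by (auto simp: w words_def)
      then show "w \<in> {w. shift_de_bruijn \<Sigma> m n w}"
        using sy X by (simp add: shift_de_bruijn_iff[OF fin ne m(1) refl] len w)
    next
      fix w assume "w \<in> {w. shift_de_bruijn \<Sigma> m n w}"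
      then have w: "w \<in> words \<Sigma> (r + m * ?N)" "factors m n ?N w \<in> permutations_of_set (words \<Sigma> n)"
        using shift_de_bruijn_iff[OF fin ne m(1) refl] len by auto
      then have "take r w \<in> ?V" "drop r w \<in> words \<Sigma> (m * ?N)"
        using set_take_subset[of r w] set_drop_subset[of r w] by (auto simp: words_def)
      moreover from this obtain ys where "ys \<in> words ?D ?N" "drop r w = concat ys"
        using bij_betw_imp_surj_on[OF concat_words_bij[OF fin, of m ?N]] by blast
      moreover from this have "w = take r w @ concat ys" by (metis append_take_drop_id)
      ultimately show "w \<in> (\<lambda>(s, ys). s @ concat ys) ` ?X"
        using X[of "take r w" ys] w(2) by (intro image_eqI[of _ _ "(take r w, ys)"]) auto
    qed
    then have "num_shift_de_bruijn \<Sigma> m n = card ?X"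
      unfolding num_shift_de_bruijn_def by (simp add: bij_betw_same_card)
    also have "\<dots> = (\<Sum>s\<in>?V. card {ys. trail ?g s ys \<in> permutations_of_set (?V \<times> ?D)})"
    proof (rule card_SigmaI)
      show "\<forall>s\<in>?V. finite {ys. trail ?g s ys \<in> permutations_of_set (?V \<times> ?D)}"
      proof
        fix s assume "s \<in> ?V"
        then have "{ys. trail ?g s ys \<in> permutations_of_set (?V \<times> ?D)} \<subseteq> words ?D ?N" using X by auto
        then show "finite {ys. trail ?g s ys \<in> permutations_of_set (?V \<times> ?D)}"
          by (rule finite_subset) (simp add: fin)
      qed
    qed (simp add: fin)
    also have "\<dots> = fact (card ?D) ^ card ?V"
    proof (rule card_euler_trails)
      show "foldl ?g s ys = foldl ?g t ys"
        if "s \<in> ?V" "t \<in> ?V" "set ys \<subseteq> ?D" "length ys = r" for s t ys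
      proof -
        \<comment> \<open>Every step drops \<open>m \<ge> 1\<close> letters, so after
          \<open>r\<close> steps the \<open>r\<close> letters of the start are gone.\<close>
        have "r \<le> m * r" and len_ys: "\<forall>y\<in>set ys. length y = m" using m that by (auto simp: words_def)
        then show ?thesis using that unfolding foldl_shift[OF len_ys] by (simp add: words_def)
      qed
      show "card {e \<in> ?V \<times> ?D. ?g (fst e) (snd e) = u} = card ?D" if "u \<in> ?V" for u
        by (rule indegree_shift[OF fin that])
    qed (use fin closed words_nonempty[OF ne] in simp_all)
    finally show ?thesis using fin by (simp add: r_def)
  qed
  ultimately show ?thesis unfolding assms(3) by blast
qed

end
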